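(* Let $v\in S_n$ and let $A$ be a $p\times p$ minor ($p\ge2$) of $Z^{(v)}$ with rows $i_1<\dots<i_p$ and columns $j_1<\dots<j_p$. Assume that $A$ has no zero row and no zero column. Then there exists a non zero path in $A$ if and only if there exists a non zero entry in the column $j_1$, say in row $i_{\alpha_1}$, such that, with successive choices of non zero entries in row $i_{\alpha_k}$ of column $j_k$ ($2\le k\le p-1$, the indices $\alpha_1,\dots,\alpha_{p-1}$ being distinct), the condition $\delta_i$ holds for each $i$, $1\le i\le p-1$.
   Context: Rows of $n\times n$ matrices are numbered from bottom to top and columns from left to right. In this statement the convention is that $v(j)$ denotes the row number, counted from the bottom, of the entry $1$ in column $j$ of $Z^{(v)}$. So $Z^{(v)}$ is the $n\times n$ matrix whose entry in row $i$ (from the bottom) and column $j$ is: $1$ if $i=v(j)$; $0$ if $i>v(j)$; $0$ if $i=v(j')$ for some $j'<j$; and an indeterminate $z_{ij}$ otherwise. A minor is a square submatrix. A path in a $p\times p$ matrix consists of one entry from each column, no two in the same row; it is non zero if it contains no zero entry. For $1\le i\le p-1$ and given $\alpha_1,\dots,\alpha_i\in\{1,\dots,p\}$ (the indices of the rows $i_{\alpha_k}$ chosen in columns $j_k$, $1\le k\le i$), condition $\delta_i$ holds if none of the following three conditions holds: (1) $v(j_{i+1})>i_p$ and $v^{-1}(i_s)<j_{i+1}$ for all $s\in\{1,\dots,p\}\setminus\{\alpha_1,\dots,\alpha_i\}$. (2) $v(j_{i+1})=i_{s_0}$ for some $1<s_0\le p$ with $s_0\in\{\alpha_1,\dots,\alpha_i\}$,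 and $v^{-1}(i_s)<j_{i+1}$ for all $s\in\{1,\dots,s_0-1\}\setminus\{\alpha_1,\dots,\alpha_i\}$; or $v(j_{i+1})=i_1$ and $1\in\{\alpha_1,\dots,\alpha_i\}$. (3) $i_{s_0}<v(j_{i+1})<i_{s_0+1}$ for some $s_0\in\{1,\dots,p-1\}$, and $v^{-1}(i_s)<j_{i+1}$ for all $s\in\{1,\dots,s_0\}\setminus\{\alpha_1,\dots,\alpha_i\}$. *)

theory Defs
  imports "HOL-Library.Poly_Mapping" "HOL-Library.FuncSet" "HOL-Combinatorics.Permutations"
begin

text \<open>Polynomials over \<open>'a\<close> in the indeterminates \<open>z\<^sub>i\<^sub>j\<close>, each indexed by the pair \<open>(i, j)\<close>:
  finitely supported maps from monomials (exponent functions of finite support) to coefficients.\<close>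

type_synonym 'a zpoly = "((nat \<times> nat) \<Rightarrow>\<^sub>0 nat) \<Rightarrow>\<^sub>0 'a"

definition indet :: "nat \<Rightarrow> nat \<Rightarrow> 'a::comm_ring_1 zpoly" where
  "indet i j = Poly_Mapping.single (Poly_Mapping.single (i, j) 1) 1"

text \<open>Matrices are functions \<open>row \<Rightarrow> column \<Rightarrow> entry\<close> with indices starting at 1. Rows are counted
  from the bottom and columns from the left. The size \<open>n\<close> is not part of the
  representation: for \<open>v\<close> a permutation of \<open>{1..n}\<close>, only the entries of \<open>Zmat v\<close> with both
  indices in \<open>{1..n}\<close> are meaningful.\<close>

definition Zmat :: "(nat \<Rightarrow> nat) \<Rightarrow> nat \<Rightarrow> nat \<Rightarrow> 'a::comm_ring_1 zpoly" where
  "Zmat v i j =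
     (if i = v j then 1
      else if i > v j then 0
      else if \<exists>j'\<in>{1..<j}. i = v j' then 0
      else indet i j)"

definition submat :: "(nat \<Rightarrow> nat \<Rightarrow> 'b) \<Rightarrow> (nat \<Rightarrow> nat) \<Rightarrow> (nat \<Rightarrow> nat) \<Rightarrow> nat \<Rightarrow> nat \<Rightarrow> 'b" where
  "submat M r c = (\<lambda>k l. M (r k) (c l))"

definition increasing_indices :: "nat \<Rightarrow> nat \<Rightarrow> (nat \<Rightarrow> nat) \<Rightarrow> bool" where
  "increasing_indices n p r \<longleftrightarrow> r \<in> {1..p} \<rightarrow> {1..n} \<and> strict_mono_on {1..p} r"

definition no_zero_row :: "nat \<Rightarrow> (nat \<Rightarrow> nat \<Rightarrow> 'b::zero) \<Rightarrow> bool" where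
  "no_zero_row p A \<longleftrightarrow> (\<forall>k\<in>{1..p}. \<exists>l\<in>{1..p}. A k l \<noteq> 0)"

definition no_zero_column :: "nat \<Rightarrow> (nat \<Rightarrow> nat \<Rightarrow> 'b::zero) \<Rightarrow> bool" where
  "no_zero_column p A \<longleftrightarrow> (\<forall>l\<in>{1..p}. \<exists>k\<in>{1..p}. A k l \<noteq> 0)"

text \<open>A path is given by the map \<open>\<sigma>\<close> sending a column to the row of the entry selected in it.\<close>

definition is_path :: "nat \<Rightarrow> (nat \<Rightarrow> nat) \<Rightarrow> bool" where
  "is_path p \<sigma> \<longleftrightarrow> \<sigma> \<in> {1..p} \<rightarrow> {1..p} \<and> inj_on \<sigma> {1..p}"

definition nonzero_path :: "nat \<Rightarrow> (nat \<Rightarrow> nat \<Rightarrow> 'b::zero) \<Rightarrow> (nat \<Rightarrow> nat) \<Rightarrow> bool" where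
  "nonzero_path p A \<sigma> \<longleftrightarrow> is_path p \<sigma> \<and> (\<forall>l\<in>{1..p}. A (\<sigma> l) l \<noteq> 0)"

text \<open>The conditions \<open>(1)\<close>, \<open>(2)\<close>, \<open>(3)\<close> whose joint failure is \<open>\<delta>\<^sub>i\<close>. Here \<open>r 1 < \<dots> < r p\<close> are the rows
  of the minor, \<open>x = j\<^sub>i\<^sub>+\<^sub>1\<close> is the column under consideration and \<open>U = {\<alpha>\<^sub>1, \<dots>, \<alpha>\<^sub>i}\<close> is the set of
  indices of the rows already used.\<close>

definition obstruction1 :: "(nat \<Rightarrow> nat) \<Rightarrow> nat \<Rightarrow> (nat \<Rightarrow> nat) \<Rightarrow> nat \<Rightarrow> nat set \<Rightarrow> bool" where
  "obstruction1 v p r x U \<longleftrightarrow> v x > r p \<and> (\<forall>s\<in>{1..p} - U. inv v (r s) < x)"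

definition obstruction2 :: "(nat \<Rightarrow> nat) \<Rightarrow> nat \<Rightarrow> (nat \<Rightarrow> nat) \<Rightarrow> nat \<Rightarrow> nat set \<Rightarrow> bool" where
  "obstruction2 v p r x U \<longleftrightarrow>
     (\<exists>s0. 1 < s0 \<and> s0 \<le> p \<and> s0 \<in> U \<and> v x = r s0 \<and> (\<forall>s\<in>{1..s0 - 1} - U. inv v (r s) < x))
     \<or> (v x = r 1 \<and> 1 \<in> U)"

definition obstruction3 :: "(nat \<Rightarrow> nat) \<Rightarrow> nat \<Rightarrow> (nat \<Rightarrow> nat) \<Rightarrow> nat \<Rightarrow> nat set \<Rightarrow> bool" where
  "obstruction3 v p r x U \<longleftrightarrow>
     (\<exists>s0\<in>{1..p - 1}. r s0 < v x \<and> v x < r (s0 + 1) \<and> (\<forall>s\<in>{1..s0} - U. inv v (r s) < x))"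

definition delta ::
  "(nat \<Rightarrow> nat) \<Rightarrow> nat \<Rightarrow> (nat \<Rightarrow> nat) \<Rightarrow> (nat \<Rightarrow> nat) \<Rightarrow> (nat \<Rightarrow> nat) \<Rightarrow> nat \<Rightarrow> bool" where
  "delta v p r c \<alpha> i \<longleftrightarrow>
     \<not> obstruction1 v p r (c (i + 1)) (\<alpha> ` {1..i}) \<and>
     \<not> obstruction2 v p r (c (i + 1)) (\<alpha> ` {1..i}) \<and>
     \<not> obstruction3 v p r (c (i + 1)) (\<alpha> ` {1..i})"

end

theory Submission
  imports Defs
begin

text \<open>
  An entry of \<open>Z\<^sup>(\<^sup>v\<^sup>)\<close> in row \<open>i\<close> and column \<open>j\<close> vanishes exactly when it lies above the \<open>1\<close> of its
  column (\<open>v j < i\<close>) or to the right of the \<open>1\<close> of its row (\<open>inv v i < j\<close>). The conditions (1), (2),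
  (3) distinguish the position of \<open>v (j\<^sub>i\<^sub>+\<^sub>1)\<close> relative to the rows of the minor: above all of them,
  equal to one of them, or strictly between two consecutive ones. In each position the condition says
  that every unused row not above the \<open>1\<close> of column \<open>j\<^sub>i\<^sub>+\<^sub>1\<close> has its own \<open>1\<close> further left. The only
  position not covered, \<open>v (j\<^sub>i\<^sub>+\<^sub>1)\<close> below all the rows, would make the column zero. Hence \<open>\<delta>\<^sub>i\<close>
  means precisely that column \<open>j\<^sub>i\<^sub>+\<^sub>1\<close> has a non zero entry in a row not used by
  \<open>\<alpha>\<^sub>1, \<dots>, \<alpha>\<^sub>i\<close> (lemma \<open>delta_iff_free_nonzero_entry\<close>).

  The theorem follows at once. Dropping the last entry of a non zero path leaves choices satisfying
  every \<open>\<delta>\<^sub>i\<close>, because the path itself provides the unused entry in the next column. Conversely,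
  the distinct non zero choices in the first \<open>p - 1\<close> columns already form a partial path, and
  \<open>\<delta>\<^sub>p\<^sub>-\<^sub>1\<close> supplies an entry of the last column that completes it.
\<close>

lemma indet_nonzero: "(indet i j :: 'a::comm_ring_1 zpoly) \<noteq> 0"
  by (metis indet_def lookup_single_eq lookup_zero one_neq_zero)

lemma Zmat_nonzero_iff:
  assumes v: "v permutes {1..n}" and i: "i \<in> {1..n}"
  shows "(Zmat v i j :: 'a::comm_ring_1 zpoly) \<noteq> 0 \<longleftrightarrow> i \<le> v j \<and> j \<le> inv v i"
proof -
  have inv_in: "inv v i \<in> {1..n}"
    using permutes_in_image[OF permutes_inv[OF v]] i by blast
  have eq: "i = v k \<longleftrightarrow> inv v i = k" for k
    using permutes_inv_eq[OF v] by metis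
  have "(\<exists>k\<in>{1..<j}. i = v k) \<longleftrightarrow> inv v i < j"
    using inv_in unfolding eq by auto
  then show ?thesis
    using eq[of j] by (auto simp: Zmat_def indet_nonzero)
qed

text \<open>The hypothesis \<open>col\<close> excludes the position \<open>v x < r 1\<close>, in which no obstruction applies
  although there is no entry to choose.\<close>

lemma obstruction_iff_no_free_row:
  assumes v: "v permutes {1..n}"
    and r: "strict_mono_on {1..p} r"
    and col: "\<exists>s\<in>{1..p}. r s \<le> v x"
  shows "obstruction1 v p r x U \<or> obstruction2 v p r x U \<or> obstruction3 v p r x U \<longleftrightarrow>
         (\<forall>s\<in>{1..p} - U. r s \<le> v x \<longrightarrow> inv v (r s) < x)"
    (is "?obstructed \<longleftrightarrow> ?blocked")
proof
  have less: "r s < r t \<longleftrightarrow> s < t" if "s \<in> {1..p}" "t \<in> {1..p}" for s t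
    using strict_mono_on_less[OF r] that by blast
  assume ?obstructed
  then consider "obstruction1 v p r x U" | "obstruction2 v p r x U" | "obstruction3 v p r x U"
    by blast
  then show ?blocked
  proof cases
    case 1
    then show ?thesis by (auto simp: obstruction1_def)
  next
    case 2
    (* The case v x = r 1 fits the pattern of the others: the range {1..1 - 1} is empty. *)
    then obtain s0 where s0: "s0 \<in> {1..p}" "s0 \<in> U" "v x = r s0"
      "\<forall>s\<in>{1..s0 - 1} - U. inv v (r s) < x"
    proof -
      from 2 consider
          s0 where "1 < s0" "s0 \<le> p" "s0 \<in> U" "v x = r s0" "\<forall>s\<in>{1..s0 - 1} - U. inv v (r s) < x"
        | "v x = r 1" "1 \<in> U"
        unfolding obstruction2_def by blast
      then show thesis
      proof cases
        case 1
        then show thesis by (intro that[of s0]) auto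
      next
        case 2
        then show thesis using col by (intro that[of 1]) auto
      qed
    qed
    show ?thesis
    proof (intro ballI impI)
      fix s assume s: "s \<in> {1..p} - U" "r s \<le> v x"
      have "s \<le> s0"
        using s s0 less[of s0 s] by auto
      moreover have "s \<noteq> s0"
        using s s0 by blast
      ultimately show "inv v (r s) < x"
        using s s0 by auto
    qed
  next
    case 3
    then obtain s0 where s0: "s0 \<in> {1..p - 1}" "v x < r (s0 + 1)"
      "\<forall>s\<in>{1..s0} - U. inv v (r s) < x"
      by (auto simp: obstruction3_def)
    show ?thesis
    proof (intro ballI impI)
      fix s assume s: "s \<in> {1..p} - U" "r s \<le> v x"
      then have "r s < r (s0 + 1)"
        using s0 by simp
      moreover have "s0 + 1 \<in> {1..p}"
        using s0(1) by auto
      ultimately have "s \<le> s0"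
        using s less[of s "s0 + 1"] by simp
      then show "inv v (r s) < x"
        using s s0 by auto
    qed
  qed
next
  have less: "r s < r t \<longleftrightarrow> s < t" if "s \<in> {1..p}" "t \<in> {1..p}" for s t
    using strict_mono_on_less[OF r] that by blast
  assume blocked: ?blocked
  define s0 where "s0 = Max {s \<in> {1..p}. r s \<le> v x}"
  have "s0 \<in> {s \<in> {1..p}. r s \<le> v x}"
    unfolding s0_def using col by (intro Max_in) auto
  then have s0: "s0 \<in> {1..p}" "r s0 \<le> v x" by auto
  have max: "s \<le> s0" if "s \<in> {1..p}" "r s \<le> v x" for s
    unfolding s0_def using that by (intro Max_ge) auto
  have below: "\<forall>s\<in>{1..s0} - U. inv v (r s) < x"
  proof
    fix s assume s: "s \<in> {1..s0} - U"
    then have "r s \<le> r s0"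
      using s0 less[of s s0] by (cases "s = s0") auto
    then show "inv v (r s) < x"
      using s s0 blocked by auto
  qed
  show ?obstructed
  proof (cases "v x = r s0")
    case True
    (* Row r s0 carries the 1 of column x, so only its having been used can block it. *)
    have "inv v (r s0) = x"
      using True permutes_inv_eq[OF v] by metis
    then have "s0 \<in> U"
      using blocked s0 by auto
    moreover have "\<forall>s\<in>{1..s0 - 1} - U. inv v (r s) < x"
      using below by auto
    moreover have "s0 = 1 \<or> 1 < s0" "s0 \<le> p"
      using s0 by auto
    ultimately have "obstruction2 v p r x U"
      unfolding obstruction2_def using True by blast
    then show ?thesis by blast
  next
    case False
    then have gt: "r s0 < v x"
      using s0 by simp
    show ?thesis
    proof (cases "s0 = p")
      case True
      then have "obstruction1 v p r x U"
        using gt below by (auto simp: obstruction1_def)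
      then show ?thesis by blast
    next
      case False
      then have "v x < r (s0 + 1)"
        using s0 max[of "s0 + 1"] by fastforce
      then have "obstruction3 v p r x U"
        unfolding obstruction3_def using False s0 gt below by (intro bexI[of _ s0]) auto
      then show ?thesis by blast
    qed
  qed
qed

lemma delta_iff_free_nonzero_entry:
  fixes A :: "nat \<Rightarrow> nat \<Rightarrow> 'a::comm_ring_1 zpoly"
  assumes v: "v permutes {1..n}"
    and r: "increasing_indices n p r"
    and A: "A = submat (Zmat v) r c"
    and col: "no_zero_column p A"
    and i: "i + 1 \<in> {1..p}"
  shows "delta v p r c \<alpha> i \<longleftrightarrow> (\<exists>s\<in>{1..p} - \<alpha> ` {1..i}. A s (i + 1) \<noteq> 0)"
proof -
  have mono: "strict_mono_on {1..p} r"
    using r by (simp add: increasing_indices_def)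
  have range: "r s \<in> {1..n}" if "s \<in> {1..p}" for s
    using r that by (auto simp: increasing_indices_def)
  have nonzero: "A s (i + 1) \<noteq> 0 \<longleftrightarrow>
      r s \<le> v (c (i + 1)) \<and> c (i + 1) \<le> inv v (r s)" if "s \<in> {1..p}" for s
    unfolding A submat_def using Zmat_nonzero_iff[OF v range[OF that]] .
  have "\<exists>s\<in>{1..p}. r s \<le> v (c (i + 1))"
    using col i nonzero unfolding no_zero_column_def by blast
  from obstruction_iff_no_free_row[OF v mono this, of "\<alpha> ` {1..i}"]
  have "delta v p r c \<alpha> i \<longleftrightarrow>
      \<not> (\<forall>s\<in>{1..p} - \<alpha> ` {1..i}. r s \<le> v (c (i + 1)) \<longrightarrow> inv v (r s) < c (i + 1))"
    unfolding delta_def by blast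
  also have "\<dots> \<longleftrightarrow> (\<exists>s\<in>{1..p} - \<alpha> ` {1..i}. A s (i + 1) \<noteq> 0)"
    using nonzero by (auto simp: not_less)
  finally show ?thesis .
qed

theorem proposition6p1p1:
  fixes n p :: nat
    and v r c :: "nat \<Rightarrow> nat"
    and A :: "nat \<Rightarrow> nat \<Rightarrow> 'a::comm_ring_1 zpoly"
  assumes "v permutes {1..n}"
    and "p \<ge> 2"
    and "increasing_indices n p r"
    and "increasing_indices n p c"
    and "A = submat (Zmat v) r c"
    and "no_zero_row p A"
    and "no_zero_column p A"
  shows "(\<exists>\<sigma>. nonzero_path p A \<sigma>) \<longleftrightarrow>
         (\<exists>\<alpha>. \<alpha> \<in> {1..p - 1} \<rightarrow> {1..p} \<and> inj_on \<alpha> {1..p - 1} \<and>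
              (\<forall>k\<in>{1..p - 1}. A (\<alpha> k) k \<noteq> 0) \<and>
              (\<forall>i\<in>{1..p - 1}. delta v p r c \<alpha> i))"
proof
  note delta_iff = delta_iff_free_nonzero_entry[OF assms(1,3,5,7)]
  assume "\<exists>\<sigma>. nonzero_path p A \<sigma>"
  then obtain \<sigma> where range: "\<sigma> \<in> {1..p} \<rightarrow> {1..p}" and inj: "inj_on \<sigma> {1..p}"
    and nonzero: "\<forall>l\<in>{1..p}. A (\<sigma> l) l \<noteq> 0"
    by (auto simp: nonzero_path_def is_path_def)
  have "delta v p r c \<sigma> i" if i: "i \<in> {1..p - 1}" for i
  proof -
    have i1: "i + 1 \<in> {1..p}"
      using i by auto
    have "\<sigma> (i + 1) \<notin> \<sigma> ` {1..i}"
      using inj_on_image_mem_iff[OF inj i1, of "{1..i}"] i1 by auto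
    then show ?thesis
      using delta_iff[OF i1] nonzero range i1 by blast
  qed
  moreover have "{1..p - 1} \<subseteq> {1..p}" by auto
  ultimately show "\<exists>\<alpha>. \<alpha> \<in> {1..p - 1} \<rightarrow> {1..p} \<and> inj_on \<alpha> {1..p - 1} \<and>
      (\<forall>k\<in>{1..p - 1}. A (\<alpha> k) k \<noteq> 0) \<and> (\<forall>i\<in>{1..p - 1}. delta v p r c \<alpha> i)"
    using range inj_on_subset[OF inj] nonzero by blast
next
  note delta_iff = delta_iff_free_nonzero_entry[OF assms(1,3,5,7)]
  assume "\<exists>\<alpha>. \<alpha> \<in> {1..p - 1} \<rightarrow> {1..p} \<and> inj_on \<alpha> {1..p - 1} \<and>
      (\<forall>k\<in>{1..p - 1}. A (\<alpha> k) k \<noteq> 0) \<and> (\<forall>i\<in>{1..p - 1}. delta v p r c \<alpha> i)"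
  then obtain \<alpha> where range: "\<alpha> \<in> {1..p - 1} \<rightarrow> {1..p}" and inj: "inj_on \<alpha> {1..p - 1}"
    and nonzero: "\<forall>k\<in>{1..p - 1}. A (\<alpha> k) k \<noteq> 0"
    and delta: "\<forall>i\<in>{1..p - 1}. delta v p r c \<alpha> i"
    by blast
  have "delta v p r c \<alpha> (p - 1)"
    using delta \<open>p \<ge> 2\<close> by auto
  then obtain s where s: "s \<in> {1..p}" "s \<notin> \<alpha> ` {1..p - 1}" "A s p \<noteq> 0"
    using delta_iff[of "p - 1"] \<open>p \<ge> 2\<close> by auto
  have columns: "{1..p} = insert p {1..p - 1}" and "p \<notin> {1..p - 1}"
    using \<open>p \<ge> 2\<close> by auto
  have "inj_on (\<alpha>(p := s)) {1..p}"
    unfolding columns using inj_on_fun_updI[OF inj s(2)] s(2) \<open>p \<notin> {1..p - 1}\<close>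
    by auto
  moreover have "\<alpha>(p := s) \<in> {1..p} \<rightarrow> {1..p}"
    using range s(1) \<open>p \<ge> 2\<close> by (intro funcsetI) (auto simp: Pi_iff)
  moreover have "\<forall>l\<in>{1..p}. A ((\<alpha>(p := s)) l) l \<noteq> 0"
    using nonzero s(3) columns by auto
  ultimately show "\<exists>\<sigma>. nonzero_path p A \<sigma>"
    unfolding nonzero_path_def is_path_def by blast
qed

end
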